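(* Let $m\geq 1$ be an integer and let $q$ be a real number with $0<q<\frac{2m}{m+1}$. Then the exponent $\frac{2m}{m+1}$ cannot be replaced by $q$ in the polynomial or in the multilinear Bohnenblust--Hille inequality; that is, both of the following hold. (i) (Polynomial case) There is no constant $K>0$ (depending only on $m$ and $q$) such that for every positive integer $N$ and every $m$-homogeneous polynomial $P(z)=\sum_{|\alpha|=m}a_\alpha z^\alpha$ on $\mathbb{C}^N$ with complex coefficients, \[ \left(\sum_{|\alpha|=m}|a_\alpha|^{q}\right)^{1/q}\leq K\,\sup_{z\in\mathbb{D}^N}|P(z)|. \] (ii) (Multilinear case) There is no constant $K>0$ (depending only on $m$ and $q$) such that for every positive integer $N$ and every $m$-linear form $T:\mathbb{C}^N\times\cdots\times\mathbb{C}^N\to\mathbb{C}$, \[ \left(\sum_{i_1,\ldots,i_m=1}^{N}|T(e_{i_1},\ldots,e_{i_m})|^{q}\right)^{1/q}\leq K\,\sup_{z_1,\ldots,z_m\in\mathbb{D}^N}|T(z_1,\ldots,z_m)|. \]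
   Context: $\mathbb{D}^N=\{z\in\mathbb{C}^N: |z_j|<1 \text{ for all } j\}$ is the open unit polydisk, and $(e_i)_{i=1}^N$ is the canonical basis of $\mathbb{C}^N$. For a multi-index $\alpha=(\alpha_1,\ldots,\alpha_N)$ of nonnegative integers, $|\alpha|=\alpha_1+\cdots+\alpha_N$ and $z^\alpha=z_1^{\alpha_1}\cdots z_N^{\alpha_N}$; sums over $|\alpha|=m$ run over all such multi-indices of length $N$. The Bohnenblust--Hille inequalities are the statements that, for each $m\geq 1$, inequalities of the forms displayed in (i) and (ii) do hold with $q=\frac{2m}{m+1}$ for some constant depending only on $m$ (not on $N$, $P$ or $T$). *)

theory Defs
  imports Complex_Main "Jordan_Normal_Form.Matrix"
begin

text \<open>
  The dimension \<open>N\<close> is quantified inside the statement, so \<open>\<complex>\<^sup>N\<close> is rendered as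
  \<open>carrier_vec N :: complex vec set\<close>, with coordinates numbered \<open>0, \<dots>, N - 1\<close> and
  canonical basis \<open>unit_vec N i\<close>, \<open>i < N\<close>.
\<close>

definition polydisk :: "nat \<Rightarrow> complex vec set" where
  "polydisk N = {z \<in> carrier_vec N. \<forall>j<N. cmod (z $ j) < 1}"

definition multi_indices :: "nat \<Rightarrow> nat \<Rightarrow> nat vec set" where
  "multi_indices N m = {\<alpha> \<in> carrier_vec N. (\<Sum>j<N. \<alpha> $ j) = m}"

text \<open>
  A homogeneous polynomial is given by its coefficient family; only the values of \<open>a\<close> on
  \<open>multi_indices N m\<close> matter.
\<close>

definition hom_poly :: "nat \<Rightarrow> nat \<Rightarrow> (nat vec \<Rightarrow> complex) \<Rightarrow> complex vec \<Rightarrow> complex" where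
  "hom_poly N m a z = (\<Sum>\<alpha>\<in>multi_indices N m. a \<alpha> * (\<Prod>j<N. (z $ j) ^ (\<alpha> $ j)))"

definition tuples :: "'a set \<Rightarrow> nat \<Rightarrow> 'a list set" where
  "tuples A m = {xs. set xs \<subseteq> A \<and> length xs = m}"

text \<open>
  An \<open>m\<close>-linear form takes its \<open>m\<close> arguments as a list; its values outside
  \<open>tuples (carrier_vec N) m\<close> are irrelevant.
\<close>

definition multilinear_form :: "nat \<Rightarrow> nat \<Rightarrow> (complex vec list \<Rightarrow> complex) \<Rightarrow> bool" where
  "multilinear_form N m T \<longleftrightarrow>
     (\<forall>xs \<in> tuples (carrier_vec N) m. \<forall>k<m.
        (\<forall>u \<in> carrier_vec N. \<forall>v \<in> carrier_vec N.
           T (xs[k := u + v]) = T (xs[k := u]) + T (xs[k := v])) \<and>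
        (\<forall>c. \<forall>v \<in> carrier_vec N. T (xs[k := c \<cdot>\<^sub>v v]) = c * T (xs[k := v])))"

text \<open>
  The index sets of the coefficient sums are finite, so these sums are genuine.  Likewise, a
  polynomial or an \<open>m\<close>-linear form is bounded on the (nonempty) polydisk, so the real
  suprema of its modulus there are genuine.
\<close>

lemma finite_multi_indices: "finite (multi_indices N m)"
proof (rule finite_subset)
  show "multi_indices N m \<subseteq> vec_of_list ` {xs. set xs \<subseteq> {..m} \<and> length xs = N}"
  proof
    fix \<alpha> assume a: "\<alpha> \<in> multi_indices N m"
    have "\<alpha> $ j \<le> m" if "j < N" for j
      using a that member_le_sum[of j "{..<N}" "\<lambda>j. \<alpha> $ j"]
      by (auto simp: multi_indices_def)
    then have "set (list_of_vec \<alpha>) \<subseteq> {..m}" "length (list_of_vec \<alpha>) = N"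
      using a by (auto simp: multi_indices_def in_set_conv_nth list_of_vec_index)
    then show "\<alpha> \<in> vec_of_list ` {xs. set xs \<subseteq> {..m} \<and> length xs = N}"
      by (intro image_eqI[where x = "list_of_vec \<alpha>"]) (auto simp: vec_list)
  qed
  show "finite (vec_of_list ` {xs. set xs \<subseteq> {..m} \<and> length xs = N})"
    by (intro finite_imageI finite_lists_length_eq) simp
qed

lemma finite_tuples: "finite A \<Longrightarrow> finite (tuples A m)"
  unfolding tuples_def by (rule finite_lists_length_eq)

end

theory Submission
  imports Defs
begin

text \<open>
  Let \<open>\<omega>\<close> be a primitive \<open>N\<close>-th root of unity.  The \<open>m\<close>-linear form on \<open>\<complex>\<^sup>N\<close> with unimodular
  coefficients \<open>\<omega>\<^bsup>i\<^sub>1 i\<^sub>2\<^esup> \<omega>\<^bsup>i\<^sub>2 i\<^sub>3\<^esup> \<cdots> \<omega>\<^bsup>i\<^sub>m\<^sub>-\<^sub>1 i\<^sub>m\<^esup>\<close> is bounded by \<open>N\<^bsup>(m+1)/2\<^esup>\<close> on the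
  polydisk, because the Fourier matrix is \<open>\<surd>N\<close> times a unitary one and multiplication by
  coordinates of modulus at most 1 does not increase the \<open>\<ell>\<^sub>2\<close>-norm.  The left-hand side of the
  inequality is \<open>N\<^bsup>m/q\<^esup>\<close>, so \<open>m/q \<le> (m+1)/2\<close>.  Evaluating the same form on \<open>m\<close> disjoint blocks of
  \<open>N\<close> variables gives an \<open>m\<close>-homogeneous polynomial in \<open>mN\<close> variables with the same coefficients
  and the same bound.
\<close>

section \<open>Orthogonality and Parseval's identity for the Fourier matrix\<close>

text \<open>Off the diagonal this is a geometric sum whose ratio is an \<open>N\<close>-th root of
  unity other than 1.\<close>

lemma sum_roots_of_unity:
  fixes j k N :: nat
  assumes "j < N" "k < N"
  shows "(\<Sum>i<N. cis (2 * pi * real i * (real j - real k) / real N)) = (if j = k then of_nat N else 0)"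
proof (cases "j = k")
  case True
  then show ?thesis by simp
next
  case False
  define x where "x = cis (2 * pi * (real j - real k) / real N)"
  have N: "N > 0" using assms by simp
  have pow: "x ^ i = cis (2 * pi * real i * (real j - real k) / real N)" for i
    unfolding x_def DeMoivre by (simp add: mult_ac)
  have "2 * pi * real N * (real j - real k) / real N = 2 * pi * of_int (int j - int k)"
    using N by simp
  then have 1: "x ^ N = 1"
    by (simp only: pow cis_multiple_2pi Ints_of_int)
  \<comment> \<open>A ratio of 1 would make \<open>N\<close> divide the nonzero integer
    \<open>j - k\<close>, whose absolute value is less than \<open>N\<close>.\<close>
  have "x \<noteq> 1"
  proof
    assume "x = 1"
    then have "cos (2 * pi * (real j - real k) / real N) = 1"
      by (simp add: x_def complex_eq_iff)
    then obtain n :: int where "2 * pi * (real j - real k) / real N = of_int n * 2 * pi"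
      using cos_one_2pi_int by auto
    then have "2 * pi * (real j - real k) = 2 * pi * (of_int n * real N)"
      using N by (simp add: field_simps)
    then have "real j - real k = of_int n * real N"
      using pi_neq_zero by simp
    then have "real_of_int (int j - int k) = real_of_int (n * int N)"
      by simp
    then have "int j - int k = n * int N"
      by (simp only: of_int_eq_iff)
    then have "int N dvd int j - int k" by simp
    then have "int N \<le> \<bar>int j - int k\<bar>"
      using False by (intro zdvd_imp_le) (auto simp: dvd_abs_iff)
    then show False using assms by linarith
  qed
  then have "(\<Sum>i<N. x ^ i) = 0"
    using 1 by (simp add: geometric_sum)
  then show ?thesis using False by (simp add: pow)
qed

text \<open>Expand each squared modulus into a double sum over \<open>j\<close> and \<open>k\<close>
  and sum over \<open>i\<close> first: orthogonality leaves only the terms with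
  \<open>j = k\<close>.\<close>

lemma dft_parseval:
  fixes w :: "nat \<Rightarrow> complex"
  shows "(\<Sum>i<N. (cmod (\<Sum>j<N. cis (2 * pi * real i * real j / real N) * w j))\<^sup>2)
    = real N * (\<Sum>j<N. (cmod (w j))\<^sup>2)"
proof -
  let ?e = "\<lambda>i j. cis (2 * pi * real i * real j / real N)"
  have ee: "?e i j * cnj (?e i k) = cis (2 * pi * real i * (real j - real k) / real N)" for i j k
    by (simp add: cis_cnj cis_mult diff_divide_distrib right_diff_distrib)
  have "complex_of_real (\<Sum>i<N. (cmod (\<Sum>j<N. ?e i j * w j))\<^sup>2)
      = (\<Sum>i<N. \<Sum>j<N. \<Sum>k<N. (?e i j * w j) * cnj (?e i k * w k))"
    by (simp only: of_real_sum complex_norm_square cnj_sum sum_product)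
  also have "\<dots> = (\<Sum>i<N. \<Sum>j<N. \<Sum>k<N.
      w j * cnj (w k) * cis (2 * pi * real i * (real j - real k) / real N))"
    unfolding ee[symmetric] by (simp only: complex_cnj_mult mult_ac)
  also have "\<dots> = (\<Sum>j<N. \<Sum>i<N. \<Sum>k<N.
      w j * cnj (w k) * cis (2 * pi * real i * (real j - real k) / real N))"
    by (rule sum.swap)
  also have "\<dots> = (\<Sum>j<N. \<Sum>k<N. \<Sum>i<N.
      w j * cnj (w k) * cis (2 * pi * real i * (real j - real k) / real N))"
    by (rule sum.cong[OF refl], rule sum.swap)
  also have "\<dots> = (\<Sum>j<N. \<Sum>k<N. w j * cnj (w k) * (if j = k then of_nat N else 0))"
    by (simp add: sum_distrib_left[symmetric] sum_roots_of_unity)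
  also have "\<dots> = (\<Sum>j<N. of_nat N * (w j * cnj (w j)))"
    by (intro sum.cong refl) (simp add: if_distrib mult_ac cong: if_cong)
  also have "\<dots> = complex_of_real (real N * (\<Sum>j<N. (cmod (w j))\<^sup>2))"
    by (simp only: sum_distrib_left[symmetric] of_real_sum of_real_mult of_real_of_nat_eq complex_norm_square)
  finally show ?thesis by (simp only: of_real_eq_iff)
qed

section \<open>The Fourier form: size, multilinearity, values on the basis\<close>

text \<open>
  The index \<open>i\<close> is the one preceding the first summation index; for \<open>i = 0\<close> the first factor
  \<open>\<omega>\<^bsup>ij\<^esup>\<close> disappears.
\<close>

fun dft_form :: "nat \<Rightarrow> nat \<Rightarrow> complex vec list \<Rightarrow> complex" where
  "dft_form N i [] = 1"
| "dft_form N i (z # zs) =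
    (\<Sum>j<N. cis (2 * pi * real i * real j / real N) * (z $ j * dft_form N j zs))"

text \<open>The empty list gives the all-ones vector, of squared Euclidean norm \<open>N\<close>;
  hence the \<open>Suc\<close>. Each further argument multiplies the entries by numbers of modulus
  at most 1 and then applies the Fourier matrix, which by Parseval costs a factor
  \<open>N\<close>.\<close>

lemma sum_dft_form_le:
  assumes "\<forall>z\<in>set zs. \<forall>j<N. cmod (z $ j) \<le> 1"
  shows "(\<Sum>i<N. (cmod (dft_form N i zs))\<^sup>2) \<le> real N ^ Suc (length zs)"
  using assms
proof (induction zs)
  case Nil
  then show ?case by simp
next
  case (Cons z zs)
  have "(\<Sum>j<N. (cmod (z $ j * dft_form N j zs))\<^sup>2) \<le> (\<Sum>j<N. (cmod (dft_form N j zs))\<^sup>2)"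
    using Cons.prems
    by (intro sum_mono power_mono) (auto simp: norm_mult intro!: mult_left_le_one_le)
  also have "\<dots> \<le> real N ^ Suc (length zs)"
    using Cons by simp
  finally show ?case
    by (simp add: dft_parseval mult_left_mono)
qed

text \<open>A single entry of a vector is at most its Euclidean norm.\<close>

lemma cmod_dft_form_le:
  assumes z: "\<forall>z\<in>set zs. \<forall>j<N. cmod (z $ j) \<le> 1" and "i < N"
  shows "cmod (dft_form N i zs) \<le> sqrt (real N) ^ Suc (length zs)"
proof -
  have "(cmod (dft_form N i zs))\<^sup>2 \<le> (\<Sum>i<N. (cmod (dft_form N i zs))\<^sup>2)"
    using \<open>i < N\<close> by (intro member_le_sum) auto
  also have "\<dots> \<le> real N ^ Suc (length zs)"
    by (rule sum_dft_form_le[OF z])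
  also have "\<dots> = (sqrt (real N) ^ Suc (length zs))\<^sup>2"
    by (simp only: power_commutes power_mult[symmetric] mult.commute[of _ 2] power_mult real_sqrt_pow2 of_nat_0_le_iff)
  finally show ?thesis
    by (rule power2_le_imp_le) simp
qed

text \<open>The updated slot is either the head, whose coordinates enter linearly, or lies in the
  tail; there the induction hypothesis is applied at every summation index, so \<open>i\<close> must
  be arbitrary.\<close>

lemma dft_form_add:
  assumes "u \<in> carrier_vec N" "v \<in> carrier_vec N" "k < length zs"
  shows "dft_form N i (zs[k := u + v]) = dft_form N i (zs[k := u]) + dft_form N i (zs[k := v])"
  using assms
  by (induction zs arbitrary: i k)
     (auto simp: algebra_simps sum.distrib[symmetric] split: nat.split intro!: sum.cong)

lemma dft_form_smult:
  assumes "v \<in> carrier_vec N" "k < length zs"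
  shows "dft_form N i (zs[k := c \<cdot>\<^sub>v v]) = c * dft_form N i (zs[k := v])"
  using assms
  by (induction zs arbitrary: i k)
     (auto simp: sum_distrib_left mult_ac split: nat.split intro!: sum.cong)

lemma multilinear_form_dft_form: "multilinear_form N m (dft_form N i)"
  by (auto simp: multilinear_form_def tuples_def dft_form_add dft_form_smult)

lemma dft_form_unit_vec_Cons:
  assumes "j < N"
  shows "dft_form N i (unit_vec N j # zs) = cis (2 * pi * real i * real j / real N) * dft_form N j zs"
proof -
  have "dft_form N i (unit_vec N j # zs)
      = (\<Sum>k<N. if k = j then cis (2 * pi * real i * real k / real N) * dft_form N k zs else 0)"
    unfolding dft_form.simps using assms by (intro sum.cong refl) auto
  then show ?thesis using assms by simp
qed

text \<open>On basis vectors every sum collapses to one term, leaving a product of points of the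
  unit circle.\<close>

lemma cmod_dft_form_unit_vec:
  assumes "set is \<subseteq> {..<N}"
  shows "cmod (dft_form N i (map (unit_vec N) is)) = 1"
  using assms
  by (induction "is" arbitrary: i) (auto simp: dft_form_unit_vec_Cons norm_mult simp del: dft_form.simps(2))

section \<open>Expansion of the form in coordinates\<close>

lemma tuples_0: "tuples A 0 = {[]}"
  by (auto simp: tuples_def)

lemma sum_tuples_Suc:
  "(\<Sum>xs\<in>tuples A (Suc m). f xs) = (\<Sum>x\<in>A. \<Sum>xs\<in>tuples A m. f (x # xs))"
proof -
  have "tuples A (Suc m) = (\<lambda>(x, xs). x # xs) ` (A \<times> tuples A m)"
    by (auto simp: tuples_def length_Suc_conv image_iff)
  moreover have "inj_on (\<lambda>(x, xs). x # xs) (A \<times> tuples A m)"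
    by (auto simp: inj_on_def)
  ultimately show ?thesis
    by (simp add: sum.reindex sum.cartesian_product case_prod_unfold)
qed

lemma card_tuples: "finite A \<Longrightarrow> card (tuples A m) = card A ^ m"
  unfolding tuples_def by (rule card_lists_length_eq)

text \<open>This exhibits the form as a combination of monomials in the coordinates, ready for
  comparison with \<open>hom_poly\<close>.\<close>

lemma dft_form_expand:
  "dft_form N i zs = (\<Sum>is\<in>tuples {..<N} (length zs).
     dft_form N i (map (unit_vec N) is) * (\<Prod>k<length zs. zs ! k $ (is ! k)))"
proof (induction zs arbitrary: i)
  case Nil
  then show ?case by (simp add: tuples_0)
next
  case (Cons z zs)
  have "(\<Sum>is\<in>tuples {..<N} (length (z # zs)).
      dft_form N i (map (unit_vec N) is) * (\<Prod>k<length (z # zs). (z # zs) ! k $ (is ! k)))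
    = (\<Sum>j<N. \<Sum>is\<in>tuples {..<N} (length zs). cis (2 * pi * real i * real j / real N) * (z $ j *
        (dft_form N j (map (unit_vec N) is) * (\<Prod>k<length zs. zs ! k $ (is ! k)))))"
    by (simp add: sum_tuples_Suc dft_form_unit_vec_Cons prod.lessThan_Suc_shift mult_ac
          del: dft_form.simps(2) prod.lessThan_Suc)
  also have "\<dots> = dft_form N i (z # zs)"
    by (simp only: sum_distrib_left[symmetric] Cons[symmetric] dft_form.simps)
  finally show ?case by (rule sym)
qed

section \<open>From the form to a homogeneous polynomial on disjoint blocks of variables\<close>

text \<open>Position \<open>k * N + i\<close> stands for coordinate \<open>i\<close> of block
  \<open>k\<close>. The result is the exponent vector of the monomial that takes from block
  \<open>k\<close> the variable numbered \<open>is ! k\<close>.\<close>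

definition block_index :: "nat \<Rightarrow> nat list \<Rightarrow> nat vec" where
  "block_index N is = vec (length is * N) (\<lambda>j. if is ! (j div N) = j mod N then 1 else 0)"

definition blocks :: "nat \<Rightarrow> nat \<Rightarrow> complex vec \<Rightarrow> complex vec list" where
  "blocks N m z = map (\<lambda>k. vec N (\<lambda>i. z $ (k * N + i))) [0..<m]"

lemma block_lt: "k < m \<Longrightarrow> i < N \<Longrightarrow> k * N + i < m * (N::nat)"
proof -
  assume "k < m" "i < N"
  then have "k * N + i < Suc k * N" by simp
  also have "\<dots> \<le> m * N" using \<open>k < m\<close> by (intro mult_le_mono1) simp
  finally show ?thesis .
qed

lemma block_index_nth:
  assumes "k < length is" "i < N"
  shows "block_index N is $ (k * N + i) = (if is ! k = i then 1 else 0)"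
  using assms by (simp add: block_index_def block_lt)

text \<open>The entry \<open>xs ! k\<close> can be read off as the place of the only 1 in block
  \<open>k\<close>. Hence distinct tuples give distinct monomials and no coefficients merge.\<close>

lemma inj_on_block_index: "inj_on (block_index N) (tuples {..<N} m)"
proof (rule inj_onI)
  fix xs ys assume xs: "xs \<in> tuples {..<N} m" and ys: "ys \<in> tuples {..<N} m"
    and eq: "block_index N xs = block_index N ys"
  show "xs = ys"
  proof (rule nth_equalityI)
    show "length xs = length ys" using xs ys by (simp add: tuples_def)
    fix k assume k: "k < length xs"
    then have "xs ! k < N" using xs nth_mem by (fastforce simp: tuples_def)
    then have "block_index N ys $ (k * N + xs ! k) = 1"
      unfolding eq[symmetric] using k by (simp add: block_index_nth)
    then show "xs ! k = ys ! k"
      using k xs ys \<open>xs ! k < N\<close> by (simp add: block_index_nth tuples_def split: if_splits)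
  qed
qed

text \<open>Each of the \<open>m\<close> blocks contains exactly one 1.\<close>

lemma block_index_in_multi_indices:
  assumes "is \<in> tuples {..<N} m"
  shows "block_index N is \<in> multi_indices (m * N) m"
proof -
  have len: "length is = m" and lt: "\<And>k. k < m \<Longrightarrow> is ! k < N"
    using assms nth_mem by (fastforce simp: tuples_def)+
  have "(\<Sum>j<m * N. block_index N is $ j) = (\<Sum>k<m. \<Sum>j=k * N..<k * N + N. block_index N is $ j)"
    by (rule sum.nat_group[symmetric])
  also have "\<dots> = (\<Sum>k<m. \<Sum>i<N. block_index N is $ (k * N + i))"
    by (rule sum.cong[OF refl], subst sum.atLeastLessThan_shift_0) (simp add: atLeast0LessThan)
  also have "\<dots> = (\<Sum>k<m. \<Sum>i<N. if is ! k = i then 1 else 0)"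
    by (intro sum.cong refl) (simp add: block_index_nth len)
  also have "\<dots> = m"
    using lt by simp
  finally show ?thesis
    by (simp add: multi_indices_def block_index_def len)
qed

lemma block_index_monomial:
  assumes "is \<in> tuples {..<N} m"
  shows "(\<Prod>j<m * N. (z $ j) ^ (block_index N is $ j)) = (\<Prod>k<m. blocks N m z ! k $ (is ! k))"
proof -
  have len: "length is = m" and lt: "\<And>k. k < m \<Longrightarrow> is ! k < N"
    using assms nth_mem by (fastforce simp: tuples_def)+
  let ?f = "\<lambda>j. (z $ j) ^ (block_index N is $ j)"
  have "(\<Prod>j<m * N. ?f j) = (\<Prod>k<m. \<Prod>j=k * N..<k * N + N. ?f j)"
    by (rule prod.nat_group[symmetric])
  also have "\<dots> = (\<Prod>k<m. \<Prod>i<N. ?f (k * N + i))"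
    by (rule prod.cong[OF refl], subst prod.atLeastLessThan_shift_0) (simp add: atLeast0LessThan)
  also have "\<dots> = (\<Prod>k<m. \<Prod>i<N. if is ! k = i then z $ (k * N + i) else 1)"
    by (intro prod.cong refl) (simp add: block_index_nth len)
  also have "\<dots> = (\<Prod>k<m. blocks N m z ! k $ (is ! k))"
    using lt by (intro prod.cong refl) (simp add: blocks_def)
  finally show ?thesis .
qed

text \<open>Coefficients of the form are carried over to exponent vectors along the injection
  \<open>block_index N\<close>; monomials not taking exactly one variable from each block get
  0.\<close>

definition block_coeff :: "nat \<Rightarrow> nat \<Rightarrow> nat vec \<Rightarrow> complex" where
  "block_coeff N m \<alpha> = (if \<alpha> \<in> block_index N ` tuples {..<N} m
     then dft_form N 0 (map (unit_vec N) (inv_into (tuples {..<N} m) (block_index N) \<alpha>)) else 0)"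

lemma block_coeff_block_index:
  "is \<in> tuples {..<N} m \<Longrightarrow>
    block_coeff N m (block_index N is) = dft_form N 0 (map (unit_vec N) is)"
  by (simp add: block_coeff_def inv_into_f_f[OF inj_on_block_index])

text \<open>Serves both for the polynomial itself and for the sum of \<open>q\<close>-th powers of
  its coefficients.\<close>

lemma sum_multi_indices_block:
  assumes "\<And>\<alpha>. \<alpha> \<notin> block_index N ` tuples {..<N} m \<Longrightarrow> f \<alpha> = 0"
  shows "(\<Sum>\<alpha>\<in>multi_indices (m * N) m. f \<alpha>) = (\<Sum>is\<in>tuples {..<N} m. f (block_index N is))"
proof -
  have "(\<Sum>\<alpha>\<in>multi_indices (m * N) m. f \<alpha>) = (\<Sum>\<alpha>\<in>block_index N ` tuples {..<N} m. f \<alpha>)"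
    using assms block_index_in_multi_indices
    by (intro sum.mono_neutral_right finite_multi_indices) auto
  also have "\<dots> = (\<Sum>is\<in>tuples {..<N} m. f (block_index N is))"
    by (simp add: sum.reindex inj_on_block_index)
  finally show ?thesis .
qed

lemma hom_poly_block_coeff:
  "hom_poly (m * N) m (block_coeff N m) z = dft_form N 0 (blocks N m z)"
proof -
  have "hom_poly (m * N) m (block_coeff N m) z
      = (\<Sum>is\<in>tuples {..<N} m. block_coeff N m (block_index N is)
          * (\<Prod>j<m * N. (z $ j) ^ (block_index N is $ j)))"
    unfolding hom_poly_def by (rule sum_multi_indices_block) (simp add: block_coeff_def)
  also have "\<dots> = (\<Sum>is\<in>tuples {..<N} m. dft_form N 0 (map (unit_vec N) is)
          * (\<Prod>k<m. blocks N m z ! k $ (is ! k)))"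
    by (intro sum.cong refl) (simp add: block_coeff_block_index block_index_monomial)
  also have "\<dots> = dft_form N 0 (blocks N m z)"
    by (subst dft_form_expand) (simp add: blocks_def)
  finally show ?thesis .
qed

section \<open>Bounds for the suprema and exact coefficient sums\<close>

lemma polydisk_nonempty: "polydisk N \<noteq> {}"
proof -
  have "0\<^sub>v N \<in> polydisk N" by (simp add: polydisk_def)
  then show ?thesis by blast
qed

lemma SUP_dft_form_le:
  assumes "N \<ge> 1"
  shows "(SUP zs\<in>tuples (polydisk N) m. cmod (dft_form N 0 zs)) \<le> sqrt (real N) ^ Suc m"
proof (rule cSUP_least)
  obtain z where "z \<in> polydisk N" using polydisk_nonempty by blast
  then have "replicate m z \<in> tuples (polydisk N) m" by (auto simp: tuples_def)
  then show "tuples (polydisk N) m \<noteq> {}" by blast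
next
  fix zs assume "zs \<in> tuples (polydisk N) m"
  then have "\<forall>z\<in>set zs. \<forall>j<N. cmod (z $ j) \<le> 1" "length zs = m"
    by (auto simp: tuples_def polydisk_def less_imp_le)
  then show "cmod (dft_form N 0 zs) \<le> sqrt (real N) ^ Suc m"
    using cmod_dft_form_le[of zs N 0] assms by simp
qed

text \<open>The blocks of a point of the polydisk have coordinates of modulus below 1, so the bound
  for the form carries over without loss.\<close>

lemma SUP_hom_poly_block_coeff_le:
  assumes "N \<ge> 1"
  shows "(SUP z\<in>polydisk (m * N). cmod (hom_poly (m * N) m (block_coeff N m) z))
    \<le> sqrt (real N) ^ Suc m"
proof (rule cSUP_least[OF polydisk_nonempty])
  fix z assume "z \<in> polydisk (m * N)"
  then have "\<forall>v\<in>set (blocks N m z). \<forall>j<N. cmod (v $ j) \<le> 1"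
    by (auto simp: blocks_def polydisk_def block_lt less_imp_le)
  moreover have "length (blocks N m z) = m" by (simp add: blocks_def)
  ultimately show "cmod (hom_poly (m * N) m (block_coeff N m) z) \<le> sqrt (real N) ^ Suc m"
    using cmod_dft_form_le[of "blocks N m z" N 0] assms by (simp add: hom_poly_block_coeff)
qed

text \<open>All coefficients are unimodular, so the sum counts the tuples.\<close>

lemma sum_powr_dft_form:
  "(\<Sum>is\<in>tuples {..<N} m. cmod (dft_form N 0 (map (unit_vec N) is)) powr q) = real N ^ m"
proof -
  have "(\<Sum>is\<in>tuples {..<N} m. cmod (dft_form N 0 (map (unit_vec N) is)) powr q)
      = (\<Sum>is\<in>tuples {..<N} m. 1)"
    by (intro sum.cong refl) (simp add: tuples_def cmod_dft_form_unit_vec)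
  then show ?thesis by (simp add: card_tuples)
qed

lemma sum_powr_block_coeff:
  "(\<Sum>\<alpha>\<in>multi_indices (m * N) m. cmod (block_coeff N m \<alpha>) powr q) = real N ^ m"
proof -
  have "(\<Sum>\<alpha>\<in>multi_indices (m * N) m. cmod (block_coeff N m \<alpha>) powr q)
      = (\<Sum>is\<in>tuples {..<N} m. cmod (block_coeff N m (block_index N is)) powr q)"
    \<comment> \<open>Vanishing coefficients contribute nothing, since
      \<open>0 powr q = 0\<close>.\<close>
    by (rule sum_multi_indices_block) (simp add: block_coeff_def)
  then show ?thesis by (simp add: block_coeff_block_index sum_powr_dft_form)
qed

section \<open>Comparison of growth rates in the dimension\<close>

text \<open>The left side grows like \<open>N\<close> to the power \<open>m / q\<close>, the right
  side like \<open>N\<close> to the power \<open>(m + 1) / 2\<close>. The assumption on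
  \<open>q\<close> makes the first exponent larger, by \<open>d\<close>, so the quotient
  \<open>N powr d\<close> cannot stay below \<open>K\<close>.\<close>

lemma powr_bound_contradiction:
  fixes m :: nat and q K :: real
  assumes q: "0 < q" "q < 2 * real m / (real m + 1)"
    and bound: "\<And>N. N \<ge> 1 \<Longrightarrow> (real N ^ m) powr (1 / q) \<le> K * sqrt (real N) ^ Suc m"
  shows False
proof -
  define d where "d = real m / q - (real m + 1) / 2"
  have d: "d > 0" using q by (simp add: d_def field_simps)
  have K: "real N powr d \<le> K" if "N \<ge> 1" for N :: nat
  proof -
    have "real N powr (real m / q) = (real N ^ m) powr (1 / q)"
      using that by (simp add: powr_realpow[symmetric] powr_powr)
    moreover have "sqrt (real N) ^ Suc m = real N powr ((real m + 1) / 2)"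
      using that by (simp only: powr_half_sqrt[symmetric] of_nat_0_le_iff)
        (simp add: powr_realpow[symmetric] powr_powr powr_add[symmetric] field_simps)
    ultimately have "real N powr (real m / q) \<le> K * real N powr ((real m + 1) / 2)"
      using bound[OF that] by simp
    then show ?thesis
      using that by (simp add: d_def powr_diff pos_divide_le_eq)
  qed
  \<comment> \<open>Chosen so that \<open>N powr d\<close> is at least
    \<open>\<bar>K\<bar> + 1\<close>, hence above \<open>K\<close>; positivity of this base also
    yields \<open>N \<ge> 1\<close>.\<close>
  define N where "N = nat \<lceil>(\<bar>K\<bar> + 1) powr (1 / d)\<rceil>"
  have "(\<bar>K\<bar> + 1) powr (1 / d) \<le> real N"
    unfolding N_def by linarith
  moreover have "(\<bar>K\<bar> + 1) powr (1 / d) > 0" by simp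
  ultimately have N: "N \<ge> 1" by linarith
  have "\<bar>K\<bar> + 1 = ((\<bar>K\<bar> + 1) powr (1 / d)) powr d"
    using d by (simp add: powr_powr)
  also have "\<dots> \<le> real N powr d"
    using d \<open>(\<bar>K\<bar> + 1) powr (1 / d) \<le> real N\<close> by (intro powr_mono2) auto
  also have "\<dots> \<le> K" by (rule K[OF N])
  finally show False by linarith
qed

theorem theorem2p2:
  fixes m :: nat and q :: real
  assumes "m \<ge> 1" and "0 < q" and "q < 2 * real m / (real m + 1)"
  shows "(\<nexists>K::real. K > 0 \<and>
            (\<forall>N\<ge>1. \<forall>a :: nat vec \<Rightarrow> complex.
               (\<Sum>\<alpha>\<in>multi_indices N m. cmod (a \<alpha>) powr q) powr (1 / q)
                 \<le> K * (SUP z\<in>polydisk N. cmod (hom_poly N m a z))))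
       \<and> (\<nexists>K::real. K > 0 \<and>
            (\<forall>N\<ge>1. \<forall>T :: complex vec list \<Rightarrow> complex. multilinear_form N m T \<longrightarrow>
               (\<Sum>is\<in>tuples {..<N} m. cmod (T (map (unit_vec N) is)) powr q) powr (1 / q)
                 \<le> K * (SUP zs\<in>tuples (polydisk N) m. cmod (T zs))))"
proof (intro conjI notI; elim exE conjE)
  fix K :: real
  assume K: "K > 0" and bh: "\<forall>N\<ge>1. \<forall>a :: nat vec \<Rightarrow> complex.
               (\<Sum>\<alpha>\<in>multi_indices N m. cmod (a \<alpha>) powr q) powr (1 / q)
                 \<le> K * (SUP z\<in>polydisk N. cmod (hom_poly N m a z))"
  show False
  proof (rule powr_bound_contradiction[OF assms(2,3)])
    fix N :: nat assume N: "N \<ge> 1"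
    \<comment> \<open>The polynomial lives in dimension \<open>m * N\<close>, so the assumed
      inequality is instantiated there; \<open>m \<ge> 1\<close> makes this dimension
      positive.\<close>
    with \<open>m \<ge> 1\<close> have "m * N \<ge> 1" by simp
    then have "(\<Sum>\<alpha>\<in>multi_indices (m * N) m. cmod (block_coeff N m \<alpha>) powr q) powr (1 / q)
        \<le> K * (SUP z\<in>polydisk (m * N). cmod (hom_poly (m * N) m (block_coeff N m) z))"
      using bh by blast
    also have "\<dots> \<le> K * sqrt (real N) ^ Suc m"
      using K by (intro mult_left_mono SUP_hom_poly_block_coeff_le N) simp
    finally show "(real N ^ m) powr (1 / q) \<le> K * sqrt (real N) ^ Suc m"
      by (simp only: sum_powr_block_coeff)
  qed
next
  fix K :: real
  assume K: "K > 0" and bh: "\<forall>N\<ge>1. \<forall>T :: complex vec list \<Rightarrow> complex. multilinear_form N m T \<longrightarrow>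
               (\<Sum>is\<in>tuples {..<N} m. cmod (T (map (unit_vec N) is)) powr q) powr (1 / q)
                 \<le> K * (SUP zs\<in>tuples (polydisk N) m. cmod (T zs))"
  show False
  proof (rule powr_bound_contradiction[OF assms(2,3)])
    fix N :: nat assume N: "N \<ge> 1"
    then have "(\<Sum>is\<in>tuples {..<N} m. cmod (dft_form N 0 (map (unit_vec N) is)) powr q) powr (1 / q)
        \<le> K * (SUP zs\<in>tuples (polydisk N) m. cmod (dft_form N 0 zs))"
      using bh multilinear_form_dft_form by blast
    also have "\<dots> \<le> K * sqrt (real N) ^ Suc m"
      using K by (intro mult_left_mono SUP_dft_form_le N) simp
    finally show "(real N ^ m) powr (1 / q) \<le> K * sqrt (real N) ^ Suc m"
      by (simp only: sum_powr_dft_form)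
  qed
qed

end
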